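(* Let $\mathbf B\in\mathbb C^{M\times M}$ be a Hermitian (possibly indefinite) matrix, and consider the generalized downlink beamforming (GDB) problem and its Lagrangian dual given in the context. Assume that the GDB problem is bounded and that Slater's condition holds for the dual problem, i.e., there exists $\hat\beta\in\mathcal F$ such that $\mathbf C(\hat\beta)\succ\frac{\hat\beta_k(\gamma_k+1)}{\gamma_k}\mathbf h_k\mathbf h_k^{H}$ for all $k=1,\dots,K$. Let $\beta^\star$ be the maximal fixed point of $I(\cdot)$ (which exists and coincides with the optimal dual solution). Then, for the iteration $\beta^{(i+1)}=I(\beta^{(i)})$, the maximal fixed point $\beta^\star$ is stable, whereas any other fixed point of $I(\cdot)$ is unstable.
   Context: Data: integers $K,M\ge1$; vectors $\mathbf h_1,\dots,\mathbf h_K\in\mathbb C^M$; scalars $\gamma_k>0$, $\sigma_k^2>0$. Put $\mathbf C(\beta)=\mathbf B+\sum_{j=1}^K\beta_j\mathbf h_j\mathbf h_j^{H}$. GDB problem: minimize $\operatorname{tr}(\mathbf B\sum_{k}\mathbf V_k)$ over Hermitian $\mathbf V_1,\dots,\mathbf V_K\succeq0$ subject to $(1+\frac1{\gamma_k})\mathbf h_k^{H}\mathbf V_k\mathbf h_k\ge\sum_{j=1}^K\mathbf h_k^{H}\mathbf V_j\mathbf h_k+\sigma_k^2$ for all $k$. "Bounded" means its optimal value is not $-\infty$. Dual problem: maximize $\sum_k\beta_k\sigma_k^2$ over $\beta\in\mathbb R^K$, $\beta\ge0$, subject to $\mathbf C(\beta)\succeq\frac{\beta_k(\gamma_k+1)}{\gamma_k}\mathbf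 h_k\mathbf h_k^{H}$ for all $k$. Interference function: $I(\beta)=[I_1(\beta),\dots,I_K(\beta)]^{T}$, $I_k(\beta)=\frac{\gamma_k}{\gamma_k+1}\frac{1}{\mathbf h_k^{H}\mathbf C(\beta)^{-1}\mathbf h_k}$ (pseudoinverse if $\mathbf C(\beta)\succeq0$ is singular with all $\mathbf h_k$ in its range). $\mathcal F_1=\{\beta\ge0:\ \mathbf C(\beta)\succeq0,\ \mathbf h_1,\dots,\mathbf h_K\in\operatorname{range}\mathbf C(\beta)\}$ and $\mathcal F=\mathcal F_1\cap\{\beta:\beta\le I(\beta)\}$. Vector inequalities are component-wise. Stability, in the sense used in the source's proof: a fixed point of $I$ is stable if there is an open ball around it such that all trajectories of $\beta^{(i+1)}=I(\beta^{(i)})$ starting in this ball converge to it; it is unstable if it does not attract nearby trajectories in this way, i.e. arbitrarily close to it there are starting points whose trajectories do not converge to it.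
   Formalization: Existence of the maximal fixed point and its coincidence with the dual optimum are proved assuming the GDB problem is feasible; an infeasible GDB (value +∞) counts as bounded, and then the dual is unbounded and the claim fails. *)

theory Defs
  imports "HOL-Analysis.Analysis"
begin

section \<open>Complex matrices\<close>

definition adjoint_mat :: "complex^'n^'m \<Rightarrow> complex^'m^'n" where
  "adjoint_mat A = (\<chi> i j. cnj (A $ j $ i))"

definition hermitian :: "complex^'m^'m \<Rightarrow> bool" where
  "hermitian A \<longleftrightarrow> adjoint_mat A = A"

text \<open>The form \<open>x\<^sup>H A x\<close> is real for Hermitian \<open>A\<close>; this is its real part.\<close>

definition quad_form :: "complex^'m^'m \<Rightarrow> complex^'m \<Rightarrow> real" where
  "quad_form A x = Re (\<Sum>i\<in>UNIV. cnj (x $ i) * (A *v x) $ i)"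

definition psd :: "complex^'m^'m \<Rightarrow> bool" where
  "psd A \<longleftrightarrow> hermitian A \<and> (\<forall>x. 0 \<le> quad_form A x)"

definition pos_def :: "complex^'m^'m \<Rightarrow> bool" where
  "pos_def A \<longleftrightarrow> hermitian A \<and> (\<forall>x. x \<noteq> 0 \<longrightarrow> 0 < quad_form A x)"

definition outer :: "complex^'m \<Rightarrow> complex^'m^'m" where
  "outer x = (\<chi> i j. x $ i * cnj (x $ j))"

text \<open>The Moore--Penrose pseudoinverse, given by the four Penrose equations. They have at most one
  solution, and for invertible matrices it is the inverse; both facts are proved below.\<close>

definition is_pinv :: "complex^'m^'m \<Rightarrow> complex^'m^'m \<Rightarrow> bool" where
  "is_pinv A X \<longleftrightarrow> A ** X ** A = A \<and> X ** A ** X = X \<and> hermitian (A ** X) \<and> hermitian (X ** A)"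

definition pinv :: "complex^'m^'m \<Rightarrow> complex^'m^'m" where
  "pinv A = (THE X. is_pinv A X)"

lemma adjoint_mat_mult: "adjoint_mat (A ** B) = adjoint_mat B ** adjoint_mat A"
  for A B :: "complex^'m^'m"
  by (simp add: adjoint_mat_def matrix_matrix_mult_def vec_eq_iff mult.commute)

lemma is_pinv_unique:
  assumes "is_pinv A X" "is_pinv A Y"
  shows "X = Y"
proof -
  have X: "A ** X ** A = A" "X ** A ** X = X" "adjoint_mat (A ** X) = A ** X"
      "adjoint_mat (X ** A) = X ** A"
    and Y: "A ** Y ** A = A" "Y ** A ** Y = Y" "adjoint_mat (A ** Y) = A ** Y"
      "adjoint_mat (Y ** A) = Y ** A"
    using assms by (auto simp: is_pinv_def hermitian_def)
  have "A ** X = A ** Y ** (A ** X)"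
    by (metis Y(1) matrix_mul_assoc)
  also have "\<dots> = adjoint_mat (A ** X ** (A ** Y))"
    by (simp add: adjoint_mat_mult [of "A ** X"] X Y)
  also have "A ** X ** (A ** Y) = A ** Y"
    by (metis X(1) matrix_mul_assoc)
  finally have 1: "A ** X = A ** Y" by (simp add: Y)
  have "X ** A = X ** A ** (Y ** A)"
    by (metis Y(1) matrix_mul_assoc)
  also have "\<dots> = adjoint_mat (Y ** A ** (X ** A))"
    by (simp add: adjoint_mat_mult [of "Y ** A"] X Y)
  also have "Y ** A ** (X ** A) = Y ** A"
    by (metis X(1) matrix_mul_assoc)
  finally have 2: "X ** A = Y ** A" by (simp add: Y)
  show ?thesis
    by (metis 1 2 X(2) Y(2) matrix_mul_assoc)
qed

lemma pinv_eqI: "is_pinv A X \<Longrightarrow> pinv A = X"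
  unfolding pinv_def by (blast intro: is_pinv_unique)

lemma pinv_eq_matrix_inv:
  assumes "invertible A"
  shows "pinv A = matrix_inv A"
proof (rule pinv_eqI)
  have "A ** matrix_inv A = mat 1" "matrix_inv A ** A = mat 1"
    using someI_ex[OF assms[unfolded invertible_def]] by (simp_all add: matrix_inv_def)
  moreover have "hermitian (mat 1 :: complex^'m^'m)"
    by (auto simp: hermitian_def adjoint_mat_def mat_def vec_eq_iff)
  ultimately show "is_pinv A (matrix_inv A)"
    by (simp add: is_pinv_def)
qed


section \<open>The generalized downlink beamforming problem\<close>

definition gdb_feasible ::
  "('k::finite \<Rightarrow> complex^'m) \<Rightarrow> ('k \<Rightarrow> real) \<Rightarrow> ('k \<Rightarrow> real) \<Rightarrow> ('k \<Rightarrow> complex^'m^'m) set" where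
  "gdb_feasible h \<gamma> \<sigma> = {V. (\<forall>k. psd (V k)) \<and>
     (\<forall>k. (1 + 1 / \<gamma> k) * quad_form (V k) (h k) \<ge> (\<Sum>j\<in>UNIV. quad_form (V j) (h k)) + (\<sigma> k)\<^sup>2)}"

definition gdb_objective :: "complex^'m^'m \<Rightarrow> ('k::finite \<Rightarrow> complex^'m^'m) \<Rightarrow> real" where
  "gdb_objective B V = Re (trace (B ** (\<Sum>k\<in>UNIV. V k)))"

definition gdb_value ::
  "complex^'m^'m \<Rightarrow> ('k::finite \<Rightarrow> complex^'m) \<Rightarrow> ('k \<Rightarrow> real) \<Rightarrow> ('k \<Rightarrow> real) \<Rightarrow> ereal" where
  "gdb_value B h \<gamma> \<sigma> = (INF V\<in>gdb_feasible h \<gamma> \<sigma>. ereal (gdb_objective B V))"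

text \<open>An infeasible problem has value \<open>\<infinity>\<close> and hence counts as bounded.\<close>

definition gdb_bounded ::
  "complex^'m^'m \<Rightarrow> ('k::finite \<Rightarrow> complex^'m) \<Rightarrow> ('k \<Rightarrow> real) \<Rightarrow> ('k \<Rightarrow> real) \<Rightarrow> bool" where
  "gdb_bounded B h \<gamma> \<sigma> \<longleftrightarrow> gdb_value B h \<gamma> \<sigma> \<noteq> -\<infinity>"


section \<open>The dual problem\<close>

text \<open>On \<^typ>\<open>real^'k\<close> the order \<open>\<le>\<close> is the component-wise one.\<close>

definition Cmat :: "complex^'m^'m \<Rightarrow> ('k::finite \<Rightarrow> complex^'m) \<Rightarrow> real^'k \<Rightarrow> complex^'m^'m" where
  "Cmat B h \<beta> = B + (\<Sum>j\<in>UNIV. \<beta> $ j *\<^sub>R outer (h j))"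

definition dual_slack ::
  "complex^'m^'m \<Rightarrow> ('k::finite \<Rightarrow> complex^'m) \<Rightarrow> ('k \<Rightarrow> real) \<Rightarrow> real^'k \<Rightarrow> 'k \<Rightarrow> complex^'m^'m" where
  "dual_slack B h \<gamma> \<beta> k = Cmat B h \<beta> - (\<beta> $ k * (\<gamma> k + 1) / \<gamma> k) *\<^sub>R outer (h k)"

definition dual_feasible ::
  "complex^'m^'m \<Rightarrow> ('k::finite \<Rightarrow> complex^'m) \<Rightarrow> ('k \<Rightarrow> real) \<Rightarrow> (real^'k) set" where
  "dual_feasible B h \<gamma> = {\<beta>. 0 \<le> \<beta> \<and> (\<forall>k. psd (dual_slack B h \<gamma> \<beta> k))}"

definition dual_objective :: "('k::finite \<Rightarrow> real) \<Rightarrow> real^'k \<Rightarrow> real" where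
  "dual_objective \<sigma> \<beta> = (\<Sum>k\<in>UNIV. \<beta> $ k * (\<sigma> k)\<^sup>2)"

definition dual_optimal ::
  "complex^'m^'m \<Rightarrow> ('k::finite \<Rightarrow> complex^'m) \<Rightarrow> ('k \<Rightarrow> real) \<Rightarrow> ('k \<Rightarrow> real) \<Rightarrow> real^'k \<Rightarrow> bool" where
  "dual_optimal B h \<gamma> \<sigma> \<beta> \<longleftrightarrow> \<beta> \<in> dual_feasible B h \<gamma> \<and>
     (\<forall>\<beta>'\<in>dual_feasible B h \<gamma>. dual_objective \<sigma> \<beta>' \<le> dual_objective \<sigma> \<beta>)"


section \<open>The interference function\<close>

text \<open>The set \<open>F1\<close> is the domain of the interference function: outside it the value of
  \<open>interference\<close> has no meaning, so fixed points and trajectories are required to lie in it.\<close>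

definition interference ::
  "complex^'m^'m \<Rightarrow> ('k::finite \<Rightarrow> complex^'m) \<Rightarrow> ('k \<Rightarrow> real) \<Rightarrow> real^'k \<Rightarrow> real^'k" where
  "interference B h \<gamma> \<beta> = (\<chi> k. \<gamma> k / (\<gamma> k + 1) * (1 / quad_form (pinv (Cmat B h \<beta>)) (h k)))"

definition F1 :: "complex^'m^'m \<Rightarrow> ('k::finite \<Rightarrow> complex^'m) \<Rightarrow> (real^'k) set" where
  "F1 B h = {\<beta>. 0 \<le> \<beta> \<and> psd (Cmat B h \<beta>) \<and> (\<forall>k. h k \<in> range (\<lambda>x. Cmat B h \<beta> *v x))}"

definition Fset ::
  "complex^'m^'m \<Rightarrow> ('k::finite \<Rightarrow> complex^'m) \<Rightarrow> ('k \<Rightarrow> real) \<Rightarrow> (real^'k) set" where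
  "Fset B h \<gamma> = F1 B h \<inter> {\<beta>. \<beta> \<le> interference B h \<gamma> \<beta>}"

definition dual_slater ::
  "complex^'m^'m \<Rightarrow> ('k::finite \<Rightarrow> complex^'m) \<Rightarrow> ('k \<Rightarrow> real) \<Rightarrow> bool" where
  "dual_slater B h \<gamma> \<longleftrightarrow> (\<exists>\<beta>\<in>Fset B h \<gamma>. \<forall>k. pos_def (dual_slack B h \<gamma> \<beta> k))"


section \<open>Fixed points and their stability\<close>

text \<open>Here \<open>D\<close> is the domain of the iterated map \<open>I\<close>.\<close>

definition fixed_point :: "'a set \<Rightarrow> ('a \<Rightarrow> 'a) \<Rightarrow> 'a \<Rightarrow> bool" where
  "fixed_point D I x \<longleftrightarrow> x \<in> D \<and> I x = x"

definition maximal_fixed_point :: "'a::ord set \<Rightarrow> ('a \<Rightarrow> 'a) \<Rightarrow> 'a \<Rightarrow> bool" where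
  "maximal_fixed_point D I x \<longleftrightarrow> fixed_point D I x \<and> (\<forall>y. fixed_point D I y \<longrightarrow> y \<le> x)"

definition trajectory_in :: "'a set \<Rightarrow> ('a \<Rightarrow> 'a) \<Rightarrow> 'a \<Rightarrow> bool" where
  "trajectory_in D I x \<longleftrightarrow> (\<forall>i. (I ^^ i) x \<in> D)"

definition stable_point :: "'a::metric_space set \<Rightarrow> ('a \<Rightarrow> 'a) \<Rightarrow> 'a \<Rightarrow> bool" where
  "stable_point D I x \<longleftrightarrow>
     (\<exists>r>0. \<forall>y\<in>ball x r. trajectory_in D I y \<and> (\<lambda>i. (I ^^ i) y) \<longlonglongrightarrow> x)"

text \<open>The witnesses of instability must have trajectories that never leave \<open>D\<close>. This makes
  instability stronger than the negation of stability: a point does not become unstable merely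
  because it lies on the boundary of the domain.\<close>

definition unstable_point :: "'a::metric_space set \<Rightarrow> ('a \<Rightarrow> 'a) \<Rightarrow> 'a \<Rightarrow> bool" where
  "unstable_point D I x \<longleftrightarrow>
     (\<forall>r>0. \<exists>y\<in>ball x r. trajectory_in D I y \<and> \<not> (\<lambda>i. (I ^^ i) y) \<longlonglongrightarrow> x)"

end

theory Submission
  imports Defs
begin

text \<open>On \<open>F1\<close> the matrix \<open>C(\<beta>)\<close> is positive definite, and \<open>t \<le> I\<^sub>k(\<beta>)\<close> holds iff
  \<open>C(\<beta>) - t (\<gamma>\<^sub>k + 1) / \<gamma>\<^sub>k h\<^sub>k h\<^sub>k\<^sup>H\<close> is positive semidefinite. Hence \<open>I\<close> is monotone and
  concave, and dual feasibility means \<open>\<beta> \<le> I(\<beta>)\<close>. The dual feasible set is closed under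
  component-wise maxima, so an optimal point is its greatest element \<open>\<beta>\<^sup>*\<close>, which monotonicity
  makes a fixed point.

  A Slater point \<open>a\<close> satisfies \<open>a < I(a)\<close> strictly, so \<open>I(a) \<ge> a + c (\<beta>\<^sup>* - a)\<close> for some
  \<open>0 < c \<le> 1\<close>. Concavity then traps the \<open>n\<close>-th iterate of a point near \<open>\<beta>\<^sup>*\<close> between
  \<open>\<beta>\<^sup>* \<plusminus> (1 - c)\<^sup>n (\<beta>\<^sup>* - a)\<close>. For another fixed point \<open>b \<le> \<beta>\<^sup>*\<close>, concavity gives
  \<open>y \<le> I(y)\<close> on the segment from \<open>b\<close> to \<open>\<beta>\<^sup>*\<close>, so trajectories starting there move away
  from \<open>b\<close>.\<close>

section \<open>Iterating monotone concave maps\<close>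

text \<open>The order-theoretic core, instantiated below with the interference function on
  \<open>F1\<close>. Upward closedness keeps iterates in \<open>D\<close> as soon as they stay above
  one of its points.\<close>

locale monotone_concave_map =
  fixes D :: "(real^'k::finite) set" and I :: "real^'k \<Rightarrow> real^'k"
  assumes upward_closed: "x \<in> D \<Longrightarrow> x \<le> y \<Longrightarrow> y \<in> D"
    and mono: "x \<in> D \<Longrightarrow> x \<le> y \<Longrightarrow> I x \<le> I y"
    and concave: "x \<in> D \<Longrightarrow> y \<in> D \<Longrightarrow> 0 \<le> t \<Longrightarrow> t \<le> 1 \<Longrightarrow>
      (1 - t) *\<^sub>R I x + t *\<^sub>R I y \<le> I ((1 - t) *\<^sub>R x + t *\<^sub>R y)"
begin

text \<open>A point with \<open>x \<le> I x\<close> is a barrier from below. It keeps trajectories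
  in \<open>D\<close> and stops them from returning to a smaller fixed point.\<close>

lemma funpow_ge:
  assumes "x \<in> D" "x \<le> I x" "x \<le> y"
  shows "x \<le> (I ^^ n) y"
proof (induction n)
  case (Suc n)
  have "x \<le> I x" by (rule assms)
  also have "\<dots> \<le> I ((I ^^ n) y)" by (rule mono [OF assms(1) Suc])
  finally show ?case by simp
qed (simp add: assms)

lemma trajectory_in_above:
  assumes "x \<in> D" "x \<le> I x" "x \<le> y"
  shows "trajectory_in D I y"
  unfolding trajectory_in_def using upward_closed funpow_ge assms by blast

text \<open>Concavity between \<open>b\<close> and \<open>a\<close>: one application of
  \<open>I\<close> shrinks the gap to \<open>b\<close>, in units of \<open>b - a\<close>, from
  \<open>s\<close> to at most \<open>s * (1 - c)\<close>.\<close>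

lemma image_below_segment:
  assumes "a \<in> D" "I b = b" "a \<le> b" "\<And>k. a $ k + c * (b $ k - a $ k) \<le> I a $ k"
    and "0 \<le> s" "s \<le> 1"
  shows "b $ k - s * (1 - c) * (b $ k - a $ k) \<le> I (b - s *\<^sub>R (b - a)) $ k"
proof -
  have "b \<in> D" using upward_closed assms by blast
  then have "(1 - s) *\<^sub>R I b + s *\<^sub>R I a \<le> I ((1 - s) *\<^sub>R b + s *\<^sub>R a)"
    using concave assms by blast
  moreover have "(1 - s) *\<^sub>R b + s *\<^sub>R a = b - s *\<^sub>R (b - a)"
    by (simp add: algebra_simps)
  ultimately have "(1 - s) * b $ k + s * I a $ k \<le> I (b - s *\<^sub>R (b - a)) $ k"
    using assms(2) by (auto simp: less_eq_vec_def dest!: spec [of _ k])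
  moreover have "s * (a $ k + c * (b $ k - a $ k)) \<le> s * I a $ k"
    by (intro mult_left_mono assms)
  ultimately show ?thesis by (simp add: algebra_simps)
qed

text \<open>Concavity is applied to \<open>b\<close>, which lies between \<open>a\<close> and the argument of \<open>I\<close>.\<close>

lemma image_above_segment:
  assumes "a \<in> D" "I b = b" "a \<le> b" "\<And>k. a $ k + c * (b $ k - a $ k) \<le> I a $ k"
    and "0 \<le> s"
  shows "I (b + s *\<^sub>R (b - a)) $ k \<le> b $ k + s * (1 - c) * (b $ k - a $ k)"
proof -
  define u where "u = b + s *\<^sub>R (b - a)"
  \<comment> \<open>This weight writes \<open>b\<close> as \<open>(1 - t) u + t a\<close>.\<close>
  define t where "t = s / (1 + s)"
  have t: "0 \<le> t" "t \<le> 1" "(1 + s) * t = s" "(1 + s) * (1 - t) = 1"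
    using assms(5) by (auto simp: t_def field_simps)
  have "a \<le> u"
    using assms(3,5) by (auto simp: u_def less_eq_vec_def add_increasing2)
  then have "u \<in> D" using upward_closed assms by blast
  then have *: "(1 - t) *\<^sub>R I u + t *\<^sub>R I a \<le> I ((1 - t) *\<^sub>R u + t *\<^sub>R a)"
    using concave assms t by blast
  have "(1 + s) *\<^sub>R ((1 - t) *\<^sub>R u + t *\<^sub>R a) = ((1 + s) * (1 - t)) *\<^sub>R u + ((1 + s) * t) *\<^sub>R a"
    by (simp add: scaleR_add_right)
  also have "\<dots> = (1 + s) *\<^sub>R b"
    by (simp only: t) (simp add: u_def algebra_simps)
  finally have "(1 - t) *\<^sub>R u + t *\<^sub>R a = b" using assms(5) by simp
  with * have "(1 - t) * I u $ k + t * I a $ k \<le> b $ k"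
    using assms(2) by (auto simp: less_eq_vec_def dest!: spec [of _ k])
  then have "(1 + s) * ((1 - t) * I u $ k + t * I a $ k) \<le> (1 + s) * b $ k"
    using assms(5) by (intro mult_left_mono) auto
  moreover have "(1 + s) * ((1 - t) * I u $ k + t * I a $ k)
      = ((1 + s) * (1 - t)) * I u $ k + ((1 + s) * t) * I a $ k"
    by (simp only: distrib_left mult.assoc)
  ultimately have "I u $ k + s * I a $ k \<le> (1 + s) * b $ k" by (simp only: t mult_1)
  moreover have "s * (a $ k + c * (b $ k - a $ k)) \<le> s * I a $ k"
    by (intro mult_left_mono assms)
  ultimately show ?thesis by (simp add: u_def algebra_simps)
qed

text \<open>Strictness at \<open>a\<close> gives a positive rate \<open>c\<close>, so the two
  segment bounds contract geometrically to \<open>b\<close> and squeeze the trajectory.\<close>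

lemma stable_fixed_point:
  assumes "a \<in> D" "\<And>k. a $ k < I a $ k" "I b = b" "a \<le> b"
  shows "stable_point D I b"
proof -
  define d where "d = b - a"
  have "I a \<le> b" using mono [OF assms(1,4)] assms(3) by simp
  then have d: "d $ k > 0" for k
    using assms(2) [of k] by (auto simp: d_def less_eq_vec_def intro: less_le_trans)
  \<comment> \<open>The smallest share of the gap \<open>d\<close> that one application of
    \<open>I\<close> to \<open>a\<close> closes; a minimum over finitely many positive numbers is
    positive.\<close>
  define c where "c = Min (range (\<lambda>k. (I a $ k - a $ k) / d $ k))"
  have c_le: "c \<le> (I a $ k - a $ k) / d $ k" for k
    by (auto simp: c_def)
  have "(I a $ k - a $ k) / d $ k \<le> 1" for k
    using d [of k] \<open>I a \<le> b\<close> by (auto simp: d_def less_eq_vec_def)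
  then have "c \<le> 1" using c_le order_trans by blast
  have "c > 0" using assms(2) d by (simp add: c_def)
  have c: "a $ k + c * (b $ k - a $ k) \<le> I a $ k" for k
    using c_le [of k] d [of k] by (simp add: d_def field_simps)
  have pow: "0 \<le> (1 - c) ^ n" "(1 - c) ^ n \<le> 1" for n
    using \<open>c \<le> 1\<close> \<open>c > 0\<close> by (auto intro: power_le_one)
  \<comment> \<open>The ball of this radius lies in the box from \<open>b - d = a\<close> to
    \<open>b + d\<close>, which is the bound below for \<open>n = 0\<close>.\<close>
  define r where "r = Min (range (\<lambda>k. d $ k))"
  have "r > 0" using d by (simp add: r_def)
  moreover have "trajectory_in D I y \<and> (\<lambda>i. (I ^^ i) y) \<longlonglongrightarrow> b" if "y \<in> ball b r" for y
  proof -
    have "\<bar>b $ k - y $ k\<bar> \<le> d $ k" for k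
    proof -
      have "\<bar>b $ k - y $ k\<bar> \<le> dist b y"
        using dist_vec_nth_le [of b k y] by (simp add: dist_real_def)
      also have "\<dots> \<le> r" using that by simp
      also have "\<dots> \<le> d $ k" by (simp add: r_def)
      finally show ?thesis .
    qed
    then have "b $ k - y $ k \<le> d $ k" "y $ k - b $ k \<le> d $ k" for k
      by (simp_all add: abs_le_iff)
    then have y: "a \<le> y" "y \<le> b + (b - a)"
      by (simp_all add: d_def less_eq_vec_def algebra_simps)
    have a: "a \<le> I a" using assms(2) by (simp add: less_eq_vec_def less_imp_le)
    note above = funpow_ge [OF assms(1) a y(1)]
    have bounds: "b - (1 - c) ^ n *\<^sub>R (b - a) \<le> (I ^^ n) y \<and>
        (I ^^ n) y \<le> b + (1 - c) ^ n *\<^sub>R (b - a)" for n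
    proof (induction n)
      case 0
      then show ?case using y by simp
    next
      case (Suc n)
      \<comment> \<open>The lower bound never drops below \<open>a\<close>, hence lies in
        \<open>D\<close>, where monotonicity applies.\<close>
      have "a \<le> b - (1 - c) ^ n *\<^sub>R (b - a)"
        using mult_right_mono [OF pow(2) less_imp_le [OF d], of n]
        by (auto simp: less_eq_vec_def d_def algebra_simps)
      then have "b - (1 - c) ^ n *\<^sub>R (b - a) \<in> D" using upward_closed assms(1) by blast
      then have "I (b - (1 - c) ^ n *\<^sub>R (b - a)) \<le> I ((I ^^ n) y)"
        using mono Suc by blast
      moreover have "I ((I ^^ n) y) \<le> I (b + (1 - c) ^ n *\<^sub>R (b - a))"
        using mono Suc upward_closed [OF assms(1) above] by blast
      ultimately show ?case
        using image_below_segment [OF assms(1,3,4) c pow [of n]]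
          image_above_segment [OF assms(1,3,4) c pow(1) [of n]]
        by (auto simp: less_eq_vec_def mult_ac intro: order_trans)
    qed
    have "(\<lambda>i. (I ^^ i) y $ k) \<longlonglongrightarrow> b $ k" for k
    proof (rule tendsto_sandwich)
      have "(\<lambda>n. (1 - c) ^ n) \<longlonglongrightarrow> 0"
        using \<open>c \<le> 1\<close> \<open>c > 0\<close> by (intro LIMSEQ_power_zero) auto
      note lim = tendsto_mult_left_zero [OF this, of "b $ k - a $ k"]
      show "(\<lambda>n. b $ k - (1 - c) ^ n * (b $ k - a $ k)) \<longlonglongrightarrow> b $ k"
        using tendsto_diff [OF tendsto_const lim] by simp
      show "(\<lambda>n. b $ k + (1 - c) ^ n * (b $ k - a $ k)) \<longlonglongrightarrow> b $ k"
        using tendsto_add [OF tendsto_const lim] by simp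
    qed (use bounds in \<open>auto simp: less_eq_vec_def\<close>)
    then show ?thesis
      using trajectory_in_above [OF assms(1) a y(1)] by (auto intro: vec_tendstoI)
  qed
  ultimately show ?thesis unfolding stable_point_def by blast
qed

text \<open>The points of the segment from \<open>a\<close> to \<open>b\<close> satisfy \<open>y \<le> I y\<close>, so their trajectories cannot
  return to \<open>a\<close>.\<close>

lemma unstable_fixed_point:
  assumes "a \<in> D" "I a = a" "I b = b" "a \<le> b" "a \<noteq> b"
  shows "unstable_point D I a"
  unfolding unstable_point_def
proof (intro allI impI)
  fix r :: real
  assume "r > 0"
  have n: "norm (b - a) > 0" using assms by simp
  \<comment> \<open>The cap 1 keeps \<open>y\<close> on the segment; half the radius puts it
    strictly inside the ball.\<close>
  define s where "s = min 1 (r / (2 * norm (b - a)))"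
  have s: "0 < s" "s \<le> 1" using \<open>r > 0\<close> n by (auto simp: s_def)
  have "s * norm (b - a) \<le> r / (2 * norm (b - a)) * norm (b - a)"
    by (intro mult_right_mono) (auto simp: s_def)
  also have "\<dots> < r" using \<open>r > 0\<close> n by simp
  finally have sr: "s * norm (b - a) < r" .
  define y where "y = (1 - s) *\<^sub>R a + s *\<^sub>R b"
  have y: "y = a + s *\<^sub>R (b - a)" by (simp add: y_def algebra_simps)
  have "y \<in> ball a r" using s sr by (simp add: y dist_norm)
  have "b \<in> D" using upward_closed assms by blast
  then have Iy: "y \<le> I y" using concave [of a b s] assms s by (simp add: y_def)
  have "a \<le> y" using s assms by (auto simp: y less_eq_vec_def)
  then have "y \<in> D" using upward_closed assms by blast
  have "\<not> (\<lambda>i. (I ^^ i) y) \<longlonglongrightarrow> a"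
  proof
    assume lim: "(\<lambda>i. (I ^^ i) y) \<longlonglongrightarrow> a"
    have "y $ k \<le> a $ k" for k
      using funpow_ge [OF \<open>y \<in> D\<close> Iy order_refl]
      by (intro LIMSEQ_le_const [OF tendsto_vec_nth [OF lim]]) (auto simp: less_eq_vec_def)
    then have "y = a" using \<open>a \<le> y\<close> by (auto simp: less_eq_vec_def vec_eq_iff intro: antisym)
    then show False using s n by (simp add: y)
  qed
  then show "\<exists>y\<in>ball a r. trajectory_in D I y \<and> \<not> (\<lambda>i. (I ^^ i) y) \<longlonglongrightarrow> a"
    using \<open>y \<in> ball a r\<close> trajectory_in_above [OF \<open>y \<in> D\<close> Iy order_refl] by blast
qed

end

section \<open>Positive semidefinite matrices\<close>

text \<open>Conjugate-linear in the first argument. It is complex-valued because Cauchy-Schwarz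
  needs the phase of \<open>cdot x (A *v y)\<close>.\<close>

definition cdot :: "complex^'m \<Rightarrow> complex^'m \<Rightarrow> complex" where
  "cdot x y = (\<Sum>i\<in>UNIV. cnj (x $ i) * y $ i)"

lemma cdot_add_left: "cdot (x + y) z = cdot x z + cdot y z"
  and cdot_add_right: "cdot z (x + y) = cdot z x + cdot z y"
  and cdot_scale_left: "cdot (c *s x) z = cnj c * cdot x z"
  and cdot_scale_right: "cdot z (c *s x) = c * cdot z x"
  by (simp_all add: cdot_def sum.distrib sum_distrib_left algebra_simps)

lemma cdot_zero_right [simp]: "cdot x 0 = 0"
  by (simp add: cdot_def)

lemma cnj_cdot: "cnj (cdot x y) = cdot y x"
  by (simp add: cdot_def mult.commute)

lemma quad_form_cdot: "quad_form A x = Re (cdot x (A *v x))"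
  by (simp add: quad_form_def cdot_def)

lemma quad_form_zero [simp]: "quad_form A 0 = 0"
  by (simp add: quad_form_cdot)

lemma hermitian_component: "hermitian A \<longleftrightarrow> (\<forall>i j. cnj (A $ j $ i) = A $ i $ j)"
  by (auto simp: hermitian_def adjoint_mat_def vec_eq_iff)

lemma hermitian_cdot:
  assumes "hermitian A"
  shows "cdot x (A *v y) = cdot (A *v x) y"
proof -
  have "cdot x (A *v y) = (\<Sum>i\<in>UNIV. \<Sum>j\<in>UNIV. cnj (x $ i) * A $ i $ j * y $ j)"
    by (simp add: cdot_def matrix_vector_mult_def sum_distrib_left mult.assoc)
  also have "\<dots> = (\<Sum>j\<in>UNIV. \<Sum>i\<in>UNIV. cnj (x $ i) * A $ i $ j * y $ j)"
    by (rule sum.swap)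
  also have "\<dots> = cdot (A *v x) y"
    using assms unfolding hermitian_component
    by (simp add: cdot_def matrix_vector_mult_def sum_distrib_left sum_distrib_right mult_ac)
  finally show ?thesis .
qed

lemma hermitian_add: "hermitian A \<Longrightarrow> hermitian B \<Longrightarrow> hermitian (A + B)"
  and hermitian_diff: "hermitian A \<Longrightarrow> hermitian B \<Longrightarrow> hermitian (A - B)"
  and hermitian_scaleR: "hermitian A \<Longrightarrow> hermitian (r *\<^sub>R A)"
  and hermitian_outer: "hermitian (outer x)"
  by (simp_all add: hermitian_component outer_def)

lemma hermitian_sum: "(\<And>j. j \<in> J \<Longrightarrow> hermitian (f j)) \<Longrightarrow> hermitian (sum f J)"
  by (simp add: hermitian_component)

lemma quad_form_add: "quad_form (A + B) x = quad_form A x + quad_form B x"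
  and quad_form_diff: "quad_form (A - B) x = quad_form A x - quad_form B x"
  by (simp_all add: quad_form_cdot matrix_vector_mult_add_rdistrib
      matrix_vector_mult_diff_rdistrib cdot_def sum.distrib sum_subtractf algebra_simps)

lemma quad_form_scaleR: "quad_form (r *\<^sub>R A) x = r * quad_form A x"
  by (simp add: quad_form_def matrix_vector_mult_def sum_distrib_left
      scaleR_conv_of_real [where 'a = complex] flip: mult.assoc)
    (simp add: sum_distrib_left algebra_simps)

lemma quad_form_sum: "quad_form (sum f J) x = (\<Sum>j\<in>J. quad_form (f j) x)"
proof (induction J rule: infinite_finite_induct)
  case (insert j J)
  then show ?case by (simp add: quad_form_add)
qed (simp_all add: quad_form_cdot)

lemma outer_mult_vec: "outer h *v x = cdot h x *s h"
  by (simp add: outer_def matrix_vector_mult_def cdot_def vec_eq_iff sum_distrib_left mult_ac)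

lemma quad_form_outer: "quad_form (outer h) x = (cmod (cdot h x))\<^sup>2"
  by (simp add: quad_form_cdot outer_mult_vec cdot_scale_right cnj_cdot [of h x, symmetric]
      flip: complex_norm_square)

text \<open>Hermitian symmetry makes the two cross terms conjugate, so they add up to twice a real
  part.\<close>

lemma quad_form_add_scale:
  assumes "hermitian A"
  shows "quad_form A (x + c *s y) =
    quad_form A x + 2 * Re (c * cdot x (A *v y)) + (cmod c)\<^sup>2 * quad_form A y"
proof -
  have "cdot y (A *v x) = cnj (cdot x (A *v y))"
    using hermitian_cdot [OF assms] by (simp add: cnj_cdot)
  then have "cdot (x + c *s y) (A *v (x + c *s y)) = cdot x (A *v x) + c * cdot x (A *v y)
      + cnj (c * cdot x (A *v y)) + (c * cnj c) * cdot y (A *v y)"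
    by (simp add: matrix_vector_right_distrib vector_scalar_commute cdot_add_left cdot_add_right
        cdot_scale_left cdot_scale_right algebra_simps)
  then show ?thesis
    unfolding quad_form_cdot complex_norm_square [symmetric] by (simp del: complex_cnj_mult)
qed

text \<open>The form is nonnegative at \<open>x\<close> minus \<open>t * cnj z\<close> times
  \<open>y\<close>, where \<open>z = cdot x (A *v y)\<close>; the factor \<open>cnj z\<close> aligns
  the phase and leaves a real quadratic in \<open>t\<close>.\<close>

lemma psd_Cauchy_Schwarz:
  assumes "psd A"
  shows "(cmod (cdot x (A *v y)))\<^sup>2 \<le> quad_form A x * quad_form A y"
proof -
  define z where "z = cdot x (A *v y)"
  have A: "hermitian A" "\<And>x. 0 \<le> quad_form A x" using assms by (auto simp: psd_def)
  have *: "0 \<le> quad_form A x - 2 * t * (cmod z)\<^sup>2 + t\<^sup>2 * (cmod z)\<^sup>2 * quad_form A y" for t :: real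
  proof -
    have "Re (- of_real t * cnj z * z) = - t * (cmod z)\<^sup>2"
      by (simp add: cmod_power2) algebra
    moreover have "(cmod (- of_real t * cnj z))\<^sup>2 = t\<^sup>2 * (cmod z)\<^sup>2"
      by (simp add: norm_mult power_mult_distrib)
    ultimately show ?thesis
      using A(2) [of "x + (- of_real t * cnj z) *s y"]
      unfolding quad_form_add_scale [OF A(1)] z_def [symmetric] by simp
  qed
  show ?thesis
  proof (cases "quad_form A y = 0")
    case True
    have "z = 0"
    proof (rule ccontr)
      assume "z \<noteq> 0"
      \<comment> \<open>This \<open>t\<close> turns the inequality into
        \<open>0 \<le> -1\<close>.\<close>
      then show False
        using * [of "(quad_form A x + 1) / (2 * (cmod z)\<^sup>2)"] True by (simp add: field_simps)
    qed
    then show ?thesis using True by (simp add: z_def)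
  next
    case False
    then have "quad_form A y > 0" using A(2) [of y] by simp
    \<comment> \<open>The quadratic in \<open>t\<close> is smallest at this value.\<close>
    then show ?thesis
      using * [of "1 / quad_form A y"] by (simp add: z_def field_simps power2_eq_square)
  qed
qed

lemma cdot_self: "cdot x x = of_real ((norm x)\<^sup>2)"
proof -
  have "(norm x)\<^sup>2 = (\<Sum>i\<in>UNIV. (cmod (x $ i))\<^sup>2)"
    by (simp add: norm_vec_def L2_set_def sum_nonneg)
  then show ?thesis
    by (simp add: cdot_def mult.commute flip: complex_norm_square)
qed

text \<open>Cauchy-Schwarz with \<open>A *v x\<close> in the other slot forces the norm of
  \<open>A *v x\<close> to vanish.\<close>

lemma psd_quad_form_eq_0:
  assumes "psd A" "quad_form A x = 0"
  shows "A *v x = 0"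
proof -
  have "(cmod (cdot (A *v x) (A *v x)))\<^sup>2 \<le> 0"
    using psd_Cauchy_Schwarz [OF assms(1), of "A *v x" x] assms(2) by simp
  then show ?thesis by (simp add: cdot_self)
qed

section \<open>Positive definite matrices minus a rank-one term\<close>

lemma pos_def_imp_psd: "pos_def A \<Longrightarrow> psd A"
  unfolding pos_def_def psd_def by (metis less_imp_le order_refl quad_form_zero)

lemma pos_def_invertible:
  assumes "pos_def A"
  shows "invertible A"
proof -
  have "x = 0" if "A *v x = 0" for x
    using assms that by (force simp: pos_def_def quad_form_cdot)
  then show ?thesis by (simp add: invertible_left_inverse matrix_left_invertible_ker)
qed

lemma pos_def_mult_pinv:
  assumes "pos_def A"
  shows "A *v (pinv A *v x) = x"
  using someI_ex [OF pos_def_invertible [OF assms, unfolded invertible_def]]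
  by (simp add: pinv_eq_matrix_inv [OF pos_def_invertible [OF assms]] matrix_inv_def
      matrix_vector_mul_assoc)

text \<open>Since \<open>A\<close> maps \<open>pinv A *v h\<close> to \<open>h\<close>, both claims
  follow from the symmetry of \<open>A\<close> at that vector.\<close>

lemma quad_form_pinv:
  assumes "pos_def A"
  shows "cdot h (pinv A *v h) = of_real (quad_form (pinv A) h)"
    and "quad_form A (pinv A *v h) = quad_form (pinv A) h"
proof -
  let ?w = "pinv A *v h"
  have "cdot ?w h = cdot h ?w"
    using hermitian_cdot [of A ?w ?w] assms by (simp add: pos_def_mult_pinv pos_def_def)
  then show "cdot h ?w = of_real (quad_form (pinv A) h)"
    by (metis Reals_cnj_iff cnj_cdot of_real_Re quad_form_cdot)
  then show "quad_form A ?w = quad_form (pinv A) h"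
    using \<open>cdot ?w h = cdot h ?w\<close> by (simp add: quad_form_cdot [of A] assms pos_def_mult_pinv)
qed

lemma pinv_mult_nonzero:
  assumes "pos_def A" "h \<noteq> 0"
  shows "pinv A *v h \<noteq> 0"
  using pos_def_mult_pinv [OF assms(1), of h] assms(2) by auto

lemma quad_form_pinv_pos:
  assumes "pos_def A" "h \<noteq> 0"
  shows "0 < quad_form (pinv A) h"
  using quad_form_pinv(2) [OF assms(1), of h] pinv_mult_nonzero [OF assms] assms(1)
  by (metis pos_def_def)

text \<open>\<open>pinv A *v h\<close> is the direction in which subtracting multiples of
  \<open>outer h\<close> first destroys definiteness, so it serves as test vector for the upper
  bounds on \<open>t\<close> below.\<close>

lemma quad_form_diff_outer_pinv:
  assumes "pos_def A"
  shows "quad_form (A - t *\<^sub>R outer h) (pinv A *v h) =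
    quad_form (pinv A) h * (1 - t * quad_form (pinv A) h)"
  by (simp add: quad_form_diff quad_form_scaleR quad_form_outer quad_form_pinv [OF assms]
      power2_eq_square algebra_simps)

text \<open>The test vector \<open>pinv A *v h\<close> gives one direction, Cauchy-Schwarz for
  \<open>A\<close> between it and \<open>x\<close> the other. This turns the interference function
  into a matrix inequality.\<close>

lemma psd_diff_outer_iff:
  assumes "pos_def A" "h \<noteq> 0"
  shows "psd (A - t *\<^sub>R outer h) \<longleftrightarrow> t \<le> 1 / quad_form (pinv A) h"
proof
  let ?q = "quad_form (pinv A) h"
  note q = quad_form_pinv_pos [OF assms]
  {
    assume "psd (A - t *\<^sub>R outer h)"
    then have "0 \<le> ?q * (1 - t * ?q)"
      using quad_form_diff_outer_pinv [OF assms(1)] by (metis psd_def)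
    then show "t \<le> 1 / ?q" using q by (simp add: zero_le_mult_iff field_simps)
  next
    assume t: "t \<le> 1 / ?q"
    have A: "hermitian A" using assms(1) by (simp add: pos_def_def)
    have "t * (cmod (cdot h x))\<^sup>2 \<le> quad_form A x" for x
    proof -
      have "cdot (pinv A *v h) (A *v x) = cdot h x"
        by (simp add: hermitian_cdot [OF A] pos_def_mult_pinv [OF assms(1)])
      then have "(cmod (cdot h x))\<^sup>2 \<le> ?q * quad_form A x"
        using psd_Cauchy_Schwarz [OF pos_def_imp_psd [OF assms(1)], of "pinv A *v h" x]
        by (simp add: quad_form_pinv(2) [OF assms(1)])
      then have "1 / ?q * (cmod (cdot h x))\<^sup>2 \<le> quad_form A x"
        using q by (simp add: field_simps)
      then show ?thesis
        using mult_right_mono [OF t, of "(cmod (cdot h x))\<^sup>2"] by simp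
    qed
    then show "psd (A - t *\<^sub>R outer h)"
      using A by (simp add: psd_def hermitian_diff hermitian_scaleR hermitian_outer
          quad_form_diff quad_form_scaleR quad_form_outer)
  }
qed

text \<open>The same test vector is nonzero because \<open>h\<close> is, so strictness
  survives.\<close>

lemma pos_def_diff_outer:
  assumes "pos_def A" "h \<noteq> 0" "pos_def (A - t *\<^sub>R outer h)"
  shows "t < 1 / quad_form (pinv A) h"
proof -
  have "0 < quad_form (pinv A) h * (1 - t * quad_form (pinv A) h)"
    using quad_form_diff_outer_pinv [OF assms(1)] pinv_mult_nonzero [OF assms(1,2)] assms(3)
    by (metis pos_def_def)
  then show ?thesis
    using quad_form_pinv_pos [OF assms(1,2)] by (simp add: zero_less_mult_iff field_simps)
qed

section \<open>Traces of products of semidefinite matrices\<close>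

lemma matrix_mult_add_left: "(B + C) ** A = B ** A + C ** A"
  and matrix_mult_diff_right: "A ** (B - C) = A ** B - A ** C"
  and matrix_mult_diff_left: "(B - C) ** A = B ** A - C ** A"
  for A B C :: "complex^'m^'m"
  by (simp_all add: matrix_matrix_mult_def vec_eq_iff sum.distrib sum_subtractf algebra_simps)

lemma matrix_mult_scaleR_right: "A ** (r *\<^sub>R B) = r *\<^sub>R (A ** B)"
  and matrix_mult_scaleR_left: "(r *\<^sub>R A) ** B = r *\<^sub>R (A ** B)"
  for A B :: "complex^'m^'m"
  by (simp_all add: matrix_matrix_mult_def vec_eq_iff scaleR_sum_right)

lemma matrix_mult_sum_right: "A ** sum f J = (\<Sum>j\<in>J. A ** f j)"
  and matrix_mult_sum_left: "sum f J ** A = (\<Sum>j\<in>J. f j ** A)"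
  for A :: "complex^'m^'m"
  by (induction J rule: infinite_finite_induct)
    (simp_all add: matrix_matrix_mult_def vec_eq_iff sum.distrib algebra_simps)

lemma trace_sum: "trace (sum f J) = (\<Sum>j\<in>J. trace (f j))"
  for f :: "'a \<Rightarrow> complex^'m^'m"
  by (simp add: trace_def) (rule sum.swap)

lemma trace_scaleR: "trace (r *\<^sub>R A) = r *\<^sub>R trace A"
  for A :: "complex^'m^'m"
  by (simp add: trace_def scaleR_sum_right)

lemma trace_mult_outer: "Re (trace (A ** outer v)) = quad_form A v"
  by (simp add: trace_def quad_form_def outer_def matrix_matrix_mult_def
      matrix_vector_mult_def sum_distrib_left mult_ac)

lemma matrix_mult_axis: "A *v axis i 1 = column i A"
  for A :: "complex^'m^'m"
proof -
  have "a * (if j = i then 1 else 0) = (if j = i then a else 0)" for a :: complex and j :: 'm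
    by simp
  then show ?thesis
    by (simp add: matrix_vector_mult_def column_def axis_def vec_eq_iff)
qed

text \<open>Nonnegativity of the reduced form at \<open>y\<close> is exactly Cauchy-Schwarz for
  \<open>V\<close> at \<open>x\<close> and \<open>y\<close>.\<close>

lemma psd_eliminate:
  assumes "psd V" "0 < quad_form V x"
  shows "psd (V - (1 / quad_form V x) *\<^sub>R outer (V *v x))"
proof -
  have V: "hermitian V" using assms by (simp add: psd_def)
  have "(cmod (cdot (V *v x) y))\<^sup>2 \<le> quad_form V x * quad_form V y" for y
    using psd_Cauchy_Schwarz [OF assms(1), of x y] by (simp add: hermitian_cdot [OF V])
  then show ?thesis
    using V assms(2) by (simp add: psd_def hermitian_diff hermitian_scaleR hermitian_outer
        quad_form_diff quad_form_scaleR quad_form_outer field_simps)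
qed

text \<open>Symmetric Gaussian elimination: subtracting a multiple of the rank-one matrix of the \<open>i\<close>-th
  column keeps \<open>V\<close> positive semidefinite and turns one more column into zero.\<close>

lemma trace_psd_mult_nonneg:
  fixes S V :: "complex^'m^'m"
  assumes "psd S" "psd V"
  shows "0 \<le> Re (trace (S ** V))"
  using assms(2)
proof (induction "card {i. V *v axis i 1 \<noteq> 0}" arbitrary: V rule: less_induct)
  case less
  show ?case
  proof (cases "\<exists>i. V *v axis i 1 \<noteq> 0")
    case False
    then have "V = 0" by (simp add: matrix_mult_axis column_def vec_eq_iff)
    then show ?thesis by (simp add: trace_def)
  next
    case True
    then obtain i where i: "V *v axis i 1 \<noteq> 0" by blast
    define e where "e = (axis i 1 :: complex^'m)"
    define W where "W = V - (1 / quad_form V e) *\<^sub>R outer (V *v e)"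
    have V: "hermitian V" using less.prems by (simp add: psd_def)
    have "quad_form V e \<noteq> 0" using i psd_quad_form_eq_0 less.prems e_def by blast
    then have e: "0 < quad_form V e" using less.prems by (simp add: psd_def order_less_le)
    have "psd W" unfolding W_def by (rule psd_eliminate [OF less.prems e])
    have "quad_form W e = 0"
    proof -
      have "cdot (V *v e) e = of_real (quad_form V e)"
        by (metis V Reals_cnj_iff cnj_cdot hermitian_cdot of_real_Re quad_form_cdot)
      then show ?thesis using e
        by (simp add: W_def quad_form_diff quad_form_scaleR quad_form_outer power2_eq_square)
    qed
    then have "W *v e = 0" by (rule psd_quad_form_eq_0 [OF \<open>psd W\<close>])
    \<comment> \<open>Columns that are already zero stay zero, so the count strictly
      decreases.\<close>
    moreover have "W *v x = 0" if "V *v x = 0" for x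
    proof (rule psd_quad_form_eq_0 [OF \<open>psd W\<close>])
      show "quad_form W x = 0"
        using that by (simp add: W_def quad_form_diff quad_form_scaleR quad_form_outer
            quad_form_cdot [of V] flip: hermitian_cdot [OF V])
    qed
    ultimately have "{i. W *v axis i 1 \<noteq> 0} \<subset> {i. V *v axis i 1 \<noteq> 0}"
      using i e_def by blast
    then have "card {i. W *v axis i 1 \<noteq> 0} < card {i. V *v axis i 1 \<noteq> 0}"
      by (intro psubset_card_mono) simp_all
    then have "0 \<le> Re (trace (S ** W))" using less.hyps \<open>psd W\<close> by blast
    \<comment> \<open>The trace against \<open>V\<close> is the trace against \<open>W\<close> plus
      this rank-one contribution.\<close>
    then have "1 / quad_form V e * quad_form S (V *v e) \<le> Re (trace (S ** V))"
      by (simp add: W_def matrix_mult_diff_right matrix_mult_scaleR_right trace_sub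
          trace_scaleR trace_mult_outer)
    moreover have "0 \<le> 1 / quad_form V e * quad_form S (V *v e)"
      using e assms(1) by (simp add: psd_def)
    ultimately show ?thesis by linarith
  qed
qed

section \<open>The beamforming problem and its dual\<close>

lemma quad_form_Cmat:
  "quad_form (Cmat B h \<beta>) x = quad_form B x + (\<Sum>j\<in>UNIV. \<beta> $ j * (cmod (cdot (h j) x))\<^sup>2)"
  by (simp add: Cmat_def quad_form_add quad_form_sum quad_form_scaleR quad_form_outer)

lemma quad_form_dual_slack:
  "quad_form (dual_slack B h \<gamma> \<beta> k) x =
    quad_form (Cmat B h \<beta>) x - \<beta> $ k * (\<gamma> k + 1) / \<gamma> k * (cmod (cdot (h k) x))\<^sup>2"
  by (simp add: dual_slack_def quad_form_diff quad_form_scaleR quad_form_outer)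

text \<open>Each coefficient of \<beta> is a squared modulus. This is the source of the monotonicity
  of the interference function.\<close>

lemma quad_form_Cmat_mono:
  assumes "\<beta> \<le> \<beta>'"
  shows "quad_form (Cmat B h \<beta>) x \<le> quad_form (Cmat B h \<beta>') x"
  using assms unfolding quad_form_Cmat
  by (intro add_left_mono sum_mono mult_right_mono) (auto simp: less_eq_vec_def)

text \<open>The matrix is affine in \<beta>, which is what makes the interference function
  concave.\<close>

lemma quad_form_Cmat_affine:
  "quad_form (Cmat B h ((1 - t) *\<^sub>R \<beta> + t *\<^sub>R \<beta>')) x =
    (1 - t) * quad_form (Cmat B h \<beta>) x + t * quad_form (Cmat B h \<beta>') x"
  by (simp add: quad_form_Cmat distrib_right sum.distrib sum_distrib_left distrib_left mult_ac)
    (simp add: algebra_simps sum_subtractf sum_distrib_left)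

text \<open>The traces of \<open>dual_slack B h \<gamma> \<beta> k ** V k\<close> are nonnegative;
  their sum is the primal objective minus the primal constraints weighted by \<beta>. The bound
  later makes the dual feasible set compact.\<close>

lemma weak_duality:
  assumes \<gamma>: "\<And>k. \<gamma> k > 0" and V: "V \<in> gdb_feasible h \<gamma> \<sigma>" and \<beta>: "\<beta> \<in> dual_feasible B h \<gamma>"
  shows "dual_objective \<sigma> \<beta> \<le> gdb_objective B V"
proof -
  let ?c = "\<lambda>k. (\<gamma> k + 1) / \<gamma> k"
  have c: "1 + 1 / \<gamma> k = ?c k" for k using \<gamma> [of k] by (simp add: field_simps)
  have "0 \<le> (\<Sum>k\<in>UNIV. Re (trace (dual_slack B h \<gamma> \<beta> k ** V k)))"
    using V \<beta> by (intro sum_nonneg trace_psd_mult_nonneg)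
      (auto simp: gdb_feasible_def dual_feasible_def)
  also have "\<dots> = (\<Sum>k\<in>UNIV. Re (trace (B ** V k))
      + (\<Sum>j\<in>UNIV. \<beta> $ j * quad_form (V k) (h j)) - \<beta> $ k * ?c k * quad_form (V k) (h k))"
  proof (intro sum.cong refl)
    fix k
    have outer: "Re (trace (outer (h j) ** V k)) = quad_form (V k) (h j)" for j
      by (simp add: trace_mul_sym [of "outer (h j)"] trace_mult_outer)
    show "Re (trace (dual_slack B h \<gamma> \<beta> k ** V k)) = Re (trace (B ** V k))
      + (\<Sum>j\<in>UNIV. \<beta> $ j * quad_form (V k) (h j)) - \<beta> $ k * ?c k * quad_form (V k) (h k)"
      by (simp add: dual_slack_def Cmat_def matrix_mult_diff_left matrix_mult_add_left
          matrix_mult_sum_left matrix_mult_scaleR_left trace_sub trace_add trace_sum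
          trace_scaleR outer)
  qed
  also have "\<dots> = gdb_objective B V + (\<Sum>k\<in>UNIV. \<Sum>j\<in>UNIV. \<beta> $ j * quad_form (V k) (h j))
      - (\<Sum>k\<in>UNIV. \<beta> $ k * ?c k * quad_form (V k) (h k))"
    by (simp add: sum.distrib sum_subtractf gdb_objective_def matrix_mult_sum_right trace_sum)
  \<comment> \<open>Swapping the sums collects the total power received by user \<open>k\<close>
    under the weight \<open>\<beta> $ k\<close>.\<close>
  also have "(\<Sum>k\<in>UNIV. \<Sum>j\<in>UNIV. \<beta> $ j * quad_form (V k) (h j)) =
      (\<Sum>k\<in>UNIV. \<beta> $ k * (\<Sum>j\<in>UNIV. quad_form (V j) (h k)))"
    by (subst sum.swap) (simp add: sum_distrib_left)
  finally have "(\<Sum>k\<in>UNIV. \<beta> $ k * (?c k * quad_form (V k) (h k)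
      - (\<Sum>j\<in>UNIV. quad_form (V j) (h k)))) \<le> gdb_objective B V"
    by (simp add: algebra_simps sum_subtractf)
  moreover have "dual_objective \<sigma> \<beta> \<le> (\<Sum>k\<in>UNIV. \<beta> $ k * (?c k * quad_form (V k) (h k)
      - (\<Sum>j\<in>UNIV. quad_form (V j) (h k))))"
    unfolding dual_objective_def
  proof (intro sum_mono mult_left_mono)
    fix k
    show "(\<sigma> k)\<^sup>2 \<le> ?c k * quad_form (V k) (h k) - (\<Sum>j\<in>UNIV. quad_form (V j) (h k))"
      using V unfolding gdb_feasible_def c by (auto simp: algebra_simps)
    show "0 \<le> \<beta> $ k" using \<beta> by (auto simp: dual_feasible_def less_eq_vec_def)
  qed
  ultimately show ?thesis by linarith
qed

section \<open>The dual feasible set and its greatest element\<close>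

locale gdb =
  fixes B :: "complex^'m^'m" and h :: "'k::finite \<Rightarrow> complex^'m" and \<gamma> :: "'k \<Rightarrow> real"
  assumes hermitian_B: "hermitian B" and \<gamma>_pos: "\<gamma> k > 0"
begin

abbreviation "C \<equiv> Cmat B h"
abbreviation "slack \<equiv> dual_slack B h \<gamma>"
abbreviation "I \<equiv> interference B h \<gamma>"

lemma hermitian_Cmat: "hermitian (C \<beta>)"
  unfolding Cmat_def
  by (intro hermitian_add hermitian_B hermitian_sum hermitian_scaleR hermitian_outer)

lemma hermitian_slack: "hermitian (slack \<beta> k)"
  unfolding dual_slack_def
  by (intro hermitian_diff hermitian_Cmat hermitian_scaleR hermitian_outer)

lemma pos_def_Cmat_mono: "pos_def (C \<beta>) \<Longrightarrow> \<beta> \<le> \<beta>' \<Longrightarrow> pos_def (C \<beta>')"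
  unfolding pos_def_def using hermitian_Cmat quad_form_Cmat_mono less_le_trans by blast

lemma psd_slack_iff: "psd (slack \<beta> k) \<longleftrightarrow>
  (\<forall>x. \<beta> $ k * (\<gamma> k + 1) / \<gamma> k * (cmod (cdot (h k) x))\<^sup>2 \<le> quad_form (C \<beta>) x)"
  by (simp add: psd_def hermitian_slack quad_form_dual_slack)

text \<open>For fixed \<open>k\<close> and \<open>x\<close> each constraint is an affine inequality
  in \<beta>, so the set is an intersection of closed sets.\<close>

lemma dual_feasible_closed: "closed (dual_feasible B h \<gamma>)"
proof -
  have "dual_feasible B h \<gamma> = (\<Inter>k. {\<beta>. 0 \<le> \<beta> $ k}) \<inter>
    (\<Inter>k. \<Inter>x. {\<beta>. \<beta> $ k * (\<gamma> k + 1) / \<gamma> k * (cmod (cdot (h k) x))\<^sup>2 \<le> quad_form (C \<beta>) x})"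
    by (auto simp: dual_feasible_def psd_slack_iff less_eq_vec_def)
  then show ?thesis
    by (simp add: quad_form_Cmat divide_inverse)
      (intro closed_Int closed_INT ballI closed_Collect_le continuous_intros)
qed

text \<open>The left side of a constraint involves one component, which the maximum takes from one
  of the two points; the right side only grows.\<close>

lemma dual_feasible_sup:
  assumes "\<beta> \<in> dual_feasible B h \<gamma>" "\<beta>' \<in> dual_feasible B h \<gamma>"
  shows "(\<chi> k. max (\<beta> $ k) (\<beta>' $ k)) \<in> dual_feasible B h \<gamma>"
proof -
  let ?m = "\<chi> k. max (\<beta> $ k) (\<beta>' $ k)"
  have le: "\<beta> \<le> ?m" "\<beta>' \<le> ?m" by (auto simp: less_eq_vec_def)
  have "?m $ k * (\<gamma> k + 1) / \<gamma> k * (cmod (cdot (h k) x))\<^sup>2 \<le> quad_form (C ?m) x" for k x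
  proof -
    have "\<beta> $ k * (\<gamma> k + 1) / \<gamma> k * (cmod (cdot (h k) x))\<^sup>2 \<le> quad_form (C ?m) x"
      "\<beta>' $ k * (\<gamma> k + 1) / \<gamma> k * (cmod (cdot (h k) x))\<^sup>2 \<le> quad_form (C ?m) x"
      using assms quad_form_Cmat_mono [OF le(1)] quad_form_Cmat_mono [OF le(2)] order_trans
      unfolding dual_feasible_def psd_slack_iff by blast+
    then show ?thesis by (simp add: max_def)
  qed
  moreover have "0 \<le> ?m"
    using assms by (auto simp: dual_feasible_def less_eq_vec_def le_max_iff_disj)
  ultimately show ?thesis by (simp add: dual_feasible_def psd_slack_iff)
qed

text \<open>Otherwise the component-wise maximum would be feasible with a larger objective, as all
  weights are positive.\<close>

lemma dual_optimal_upper_bound: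
  assumes "\<And>k. (\<sigma> k)\<^sup>2 > 0" "dual_optimal B h \<gamma> \<sigma> \<beta>" "\<beta>' \<in> dual_feasible B h \<gamma>"
  shows "\<beta>' \<le> \<beta>"
proof (rule ccontr)
  assume "\<not> \<beta>' \<le> \<beta>"
  then obtain k where k: "\<beta> $ k < \<beta>' $ k" by (auto simp: less_eq_vec_def not_le)
  let ?m = "\<chi> k. max (\<beta> $ k) (\<beta>' $ k)"
  have "dual_objective \<sigma> \<beta> < dual_objective \<sigma> ?m"
    unfolding dual_objective_def
    by (rule sum_strict_mono_ex1) (use k assms(1) in \<open>auto simp: less_max_iff_disj intro!: mult_right_mono exI [of _ k]\<close>)
  moreover have "?m \<in> dual_feasible B h \<gamma>"
    using assms dual_feasible_sup by (auto simp: dual_optimal_def)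
  ultimately show False using assms(2) by (auto simp: dual_optimal_def not_less [symmetric])
qed

lemma dual_optimal_unique:
  assumes "\<And>k. (\<sigma> k)\<^sup>2 > 0" "dual_optimal B h \<gamma> \<sigma> \<beta>" "dual_optimal B h \<gamma> \<sigma> \<beta>'"
  shows "\<beta> = \<beta>'"
  using dual_optimal_upper_bound [of \<sigma>] assms by (meson antisym dual_optimal_def)

text \<open>With a zero channel, component \<open>k\<close> could be raised without violating any
  constraint, contradicting the upper bound.\<close>

lemma dual_optimal_nonzero_channel:
  assumes "\<And>k. (\<sigma> k)\<^sup>2 > 0" "dual_optimal B h \<gamma> \<sigma> \<beta>"
  shows "h k \<noteq> 0"
proof
  assume "h k = 0"
  let ?\<beta> = "\<beta> + axis k 1"
  have le: "\<beta> \<le> ?\<beta>" by (auto simp: less_eq_vec_def axis_def)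
  have \<beta>: "\<beta> \<in> dual_feasible B h \<gamma>" using assms by (simp add: dual_optimal_def)
  have "psd (slack ?\<beta> j)" for j
  proof (cases "j = k")
    case True
    \<comment> \<open>For a zero channel, constraint \<open>k\<close> just says that
      \<open>C \<beta>\<close> is positive semidefinite.\<close>
    have "0 \<le> quad_form (C \<beta>) x" for x
      using \<beta> True \<open>h k = 0\<close>
      by (auto simp: dual_feasible_def psd_slack_iff cdot_def dest!: spec [of _ k])
    then have "0 \<le> quad_form (C ?\<beta>) x" for x
      using quad_form_Cmat_mono [OF le] order_trans by blast
    then show ?thesis using True \<open>h k = 0\<close> by (simp add: psd_slack_iff cdot_def)
  next
    case False
    then have eq: "?\<beta> $ j = \<beta> $ j" by (simp add: axis_def)
    show ?thesis
      unfolding psd_slack_iff eq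
    proof
      fix x
      have "\<beta> $ j * (\<gamma> j + 1) / \<gamma> j * (cmod (cdot (h j) x))\<^sup>2 \<le> quad_form (C \<beta>) x"
        using \<beta> psd_slack_iff by (simp add: dual_feasible_def)
      also have "\<dots> \<le> quad_form (C ?\<beta>) x" by (rule quad_form_Cmat_mono [OF le])
      finally show "\<beta> $ j * (\<gamma> j + 1) / \<gamma> j * (cmod (cdot (h j) x))\<^sup>2 \<le> quad_form (C ?\<beta>) x" .
    qed
  qed
  moreover have "0 \<le> ?\<beta>" using \<beta> le by (auto simp: dual_feasible_def)
  ultimately have "?\<beta> \<in> dual_feasible B h \<gamma>" by (simp add: dual_feasible_def)
  then have "?\<beta> \<le> \<beta>" using dual_optimal_upper_bound [of \<sigma>] assms by blast
  then show False by (auto simp: less_eq_vec_def axis_def dest: spec [of _ k])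
qed

text \<open>Weak duality against a single primal point bounds every component, so a continuous
  objective is maximized over a compact set.\<close>

lemma dual_optimal_exists:
  assumes \<sigma>: "\<And>k. (\<sigma> k)\<^sup>2 > 0" and "gdb_feasible h \<gamma> \<sigma> \<noteq> {}"
    and "dual_feasible B h \<gamma> \<noteq> {}"
  obtains \<beta> where "dual_optimal B h \<gamma> \<sigma> \<beta>"
proof -
  let ?D = "dual_feasible B h \<gamma>"
  obtain V where V: "V \<in> gdb_feasible h \<gamma> \<sigma>" using assms by blast
  define b where "b = (\<chi> k. gdb_objective B V / (\<sigma> k)\<^sup>2)"
  have "?D \<subseteq> {0..b}"
  proof
    fix \<beta> assume \<beta>: "\<beta> \<in> ?D"
    then have nonneg: "0 \<le> \<beta> $ k" for k by (auto simp: dual_feasible_def less_eq_vec_def)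
    have "\<beta> $ k * (\<sigma> k)\<^sup>2 \<le> gdb_objective B V" for k
    proof -
      have "\<beta> $ k * (\<sigma> k)\<^sup>2 \<le> dual_objective \<sigma> \<beta>"
        unfolding dual_objective_def using nonneg by (intro member_le_sum) auto
      also have "\<dots> \<le> gdb_objective B V" using weak_duality \<gamma>_pos V \<beta> by blast
      finally show ?thesis .
    qed
    then show "\<beta> \<in> {0..b}"
      using nonneg \<sigma> by (auto simp: less_eq_vec_def b_def pos_le_divide_eq)
  qed
  moreover have "{0..b} = cbox 0 b"
    by (auto simp: less_eq_vec_def mem_box_cart)
  ultimately have "compact ?D"
    by (metis bounded_cbox bounded_subset compact_eq_bounded_closed dual_feasible_closed)
  moreover have "continuous_on ?D (dual_objective \<sigma>)"
    unfolding dual_objective_def by (intro continuous_intros)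
  ultimately show thesis
    using continuous_attains_sup [of ?D "dual_objective \<sigma>"] assms that
    by (auto simp: dual_optimal_def)
qed

end

section \<open>The interference function in the presence of a Slater point\<close>

locale gdb_slater = gdb B h \<gamma>
  for B :: "complex^'m^'m" and h :: "'k::finite \<Rightarrow> complex^'m" and \<gamma> +
  fixes \<beta>0 :: "real^'k"
  assumes channel_nonzero: "h k \<noteq> 0"
    and slater_nonneg: "0 \<le> \<beta>0"
    and slater: "pos_def (slack \<beta>0 k)"
begin

lemma pos_def_Cmat_slater: "pos_def (C \<beta>0)"
  unfolding pos_def_def
proof (intro conjI hermitian_Cmat allI impI)
  fix x :: "complex^'m"
  assume "x \<noteq> 0"
  \<comment> \<open>Types are nonempty, so an index exists; any one serves.\<close>
  obtain k :: 'k where True by blast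
  have "0 < quad_form (slack \<beta>0 k) x"
    using slater \<open>x \<noteq> 0\<close> by (simp add: pos_def_def)
  also have "\<dots> \<le> quad_form (C \<beta>0) x"
    using slater_nonneg \<gamma>_pos [of k] by (simp add: quad_form_dual_slack less_eq_vec_def)
  finally show "0 < quad_form (C \<beta>0) x" .
qed

text \<open>A kernel vector of \<open>C \<beta>\<close> is orthogonal to its range, hence to every \<open>h k\<close>, so the quadratic
  forms of \<open>C \<beta>\<close> and \<open>C \<beta>0\<close> agree on it. Thus the pseudoinverse is an inverse on \<^const>\<open>F1\<close>.\<close>

lemma F1_iff: "\<beta> \<in> F1 B h \<longleftrightarrow> 0 \<le> \<beta> \<and> pos_def (C \<beta>)"
proof (intro iffI conjI)
  assume \<beta>: "\<beta> \<in> F1 B h"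
  then show "0 \<le> \<beta>" by (simp add: F1_def)
  have psd: "psd (C \<beta>)" using \<beta> by (simp add: F1_def)
  have "quad_form (C \<beta>) x \<noteq> 0" if "x \<noteq> 0" for x
  proof
    assume 0: "quad_form (C \<beta>) x = 0"
    then have ker: "C \<beta> *v x = 0" using psd psd_quad_form_eq_0 by blast
    have orth: "cdot (h k) x = 0" for k
    proof -
      obtain u where "h k = C \<beta> *v u" using \<beta> by (auto simp: F1_def)
      then show ?thesis by (simp add: ker flip: hermitian_cdot [OF hermitian_Cmat])
    qed
    have "quad_form (C \<beta>0) x = quad_form (C \<beta>) x"
      unfolding quad_form_Cmat by (simp add: orth)
    then show False using pos_def_Cmat_slater that 0 by (metis less_irrefl pos_def_def)
  qed
  then show "pos_def (C \<beta>)" using psd by (simp add: psd_def pos_def_def order_less_le)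
next
  assume "0 \<le> \<beta> \<and> pos_def (C \<beta>)"
  then show "\<beta> \<in> F1 B h"
    using pos_def_mult_pinv [of "C \<beta>"] pos_def_imp_psd unfolding F1_def
    by (auto intro: range_eqI [OF sym])
qed

text \<open>The rank-one criterion removes the inverse. For each \<open>x\<close> the resulting
  inequality is affine in \<open>t\<close> and \<beta> jointly.\<close>

lemma le_interference_iff:
  assumes "pos_def (C \<beta>)"
  shows "t \<le> I \<beta> $ k \<longleftrightarrow>
    (\<forall>x. t * (\<gamma> k + 1) / \<gamma> k * (cmod (cdot (h k) x))\<^sup>2 \<le> quad_form (C \<beta>) x)"
proof -
  have "t \<le> I \<beta> $ k \<longleftrightarrow> t * (\<gamma> k + 1) / \<gamma> k \<le> 1 / quad_form (pinv (C \<beta>)) (h k)"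
    using \<gamma>_pos [of k] quad_form_pinv_pos [OF assms channel_nonzero, of k]
    by (simp add: interference_def field_simps add_pos_pos)
  also have "\<dots> \<longleftrightarrow> psd (C \<beta> - (t * (\<gamma> k + 1) / \<gamma> k) *\<^sub>R outer (h k))"
    using psd_diff_outer_iff [OF assms channel_nonzero] by simp
  finally show ?thesis
    by (simp add: psd_def hermitian_diff hermitian_Cmat hermitian_scaleR hermitian_outer
        quad_form_diff quad_form_scaleR quad_form_outer)
qed

lemma dual_feasible_iff:
  assumes "pos_def (C \<beta>)"
  shows "\<beta> \<in> dual_feasible B h \<gamma> \<longleftrightarrow> 0 \<le> \<beta> \<and> \<beta> \<le> I \<beta>"
  by (simp add: dual_feasible_def psd_slack_iff less_eq_vec_def [of _ "I \<beta>"]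
      le_interference_iff [OF assms])

lemma slater_dual_feasible: "\<beta>0 \<in> dual_feasible B h \<gamma>"
  using slater slater_nonneg pos_def_imp_psd by (auto simp: dual_feasible_def)

lemma slater_less_interference: "\<beta>0 $ k < I \<beta>0 $ k"
proof -
  have "\<beta>0 $ k * (\<gamma> k + 1) / \<gamma> k < 1 / quad_form (pinv (C \<beta>0)) (h k)"
    using slater [of k] unfolding dual_slack_def
    by (rule pos_def_diff_outer [OF pos_def_Cmat_slater channel_nonzero])
  then show ?thesis
    using \<gamma>_pos [of k] quad_form_pinv_pos [OF pos_def_Cmat_slater channel_nonzero, of k]
    by (simp add: interference_def field_simps add_pos_pos)
qed

text \<open>Both properties are read off from \<open>le_interference_iff\<close> by inserting the
  value of \<open>I\<close> for \<open>t\<close>.\<close>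

sublocale monotone_concave_map "F1 B h" I
proof
  fix x y assume "x \<in> F1 B h" and le: "x \<le> y"
  then have x: "0 \<le> x" "pos_def (C x)" by (simp_all add: F1_iff)
  then have y: "0 \<le> y" "pos_def (C y)" using le pos_def_Cmat_mono by auto
  then show "y \<in> F1 B h" by (simp add: F1_iff)
  show "I x \<le> I y"
    unfolding less_eq_vec_def
  proof
    fix k
    show "I x $ k \<le> I y $ k"
      using le_interference_iff [OF x(2), of "I x $ k" k] quad_form_Cmat_mono [OF le] order_trans
      unfolding le_interference_iff [OF y(2)] by blast
  qed
next
  fix x y :: "real^'k" and t :: real
  assume "x \<in> F1 B h" "y \<in> F1 B h" and t: "0 \<le> t" "t \<le> 1"
  then have x: "pos_def (C x)" and y: "pos_def (C y)" by (simp_all add: F1_iff)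
  let ?z = "(1 - t) *\<^sub>R x + t *\<^sub>R y"
  have z: "pos_def (C ?z)"
    unfolding pos_def_def
  proof (intro conjI hermitian_Cmat allI impI)
    fix u :: "complex^'m"
    assume "u \<noteq> 0"
    then have "0 < quad_form (C x) u" "0 < quad_form (C y) u"
      using x y by (simp_all add: pos_def_def)
    \<comment> \<open>At \<open>t = 1\<close> only \<open>C y\<close> contributes; otherwise the
      \<open>C x\<close> term is strictly positive.\<close>
    then show "0 < quad_form (C ?z) u"
      using t unfolding quad_form_Cmat_affine
      by (cases "t = 1") (auto intro!: add_pos_nonneg)
  qed
  show "(1 - t) *\<^sub>R I x + t *\<^sub>R I y \<le> I ?z"
    unfolding less_eq_vec_def
  proof
    fix k
    let ?q = "\<lambda>u. (\<gamma> k + 1) / \<gamma> k * (cmod (cdot (h k) u))\<^sup>2"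
    have "((1 - t) * I x $ k + t * I y $ k) * ?q u \<le> quad_form (C ?z) u" for u
    proof -
      have "I x $ k * ?q u \<le> quad_form (C x) u" "I y $ k * ?q u \<le> quad_form (C y) u"
        using le_interference_iff [OF x, of "I x $ k" k] le_interference_iff [OF y, of "I y $ k" k]
        by (auto simp: mult.assoc)
      then have "(1 - t) * (I x $ k * ?q u) + t * (I y $ k * ?q u) \<le> quad_form (C ?z) u"
        unfolding quad_form_Cmat_affine using t by (intro add_mono mult_left_mono) auto
      then show ?thesis by (simp only: distrib_right mult.assoc)
    qed
    then show "((1 - t) *\<^sub>R I x + t *\<^sub>R I y) $ k \<le> I ?z $ k"
      by (simp add: le_interference_iff [OF z] mult.assoc)
  qed
qed

lemma slater_in_F1: "\<beta>0 \<in> F1 B h"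
  using pos_def_Cmat_slater slater_nonneg by (simp add: F1_iff)

text \<open>Monotonicity makes \<open>I \<beta>\<close> feasible along with \<beta>, so
  \<open>I \<beta> \<le> \<beta>\<close> because \<beta> is the greatest feasible point. Fixed
  points are feasible too, hence below \<beta>.\<close>

lemma dual_optimal_maximal_fixed_point:
  assumes "\<And>k. (\<sigma> k)\<^sup>2 > 0" "dual_optimal B h \<gamma> \<sigma> \<beta>"
  shows "maximal_fixed_point (F1 B h) I \<beta>"
proof -
  have max: "\<beta>' \<le> \<beta>" if "\<beta>' \<in> dual_feasible B h \<gamma>" for \<beta>'
    using dual_optimal_upper_bound [of \<sigma>] assms that by blast
  have "\<beta> \<in> F1 B h"
    using upward_closed [OF slater_in_F1] max slater_dual_feasible by blast
  then have pd: "0 \<le> \<beta>" "pos_def (C \<beta>)" by (simp_all add: F1_iff)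
  have "\<beta> \<le> I \<beta>"
    using assms dual_feasible_iff [OF pd(2)] by (simp add: dual_optimal_def)
  then have "I \<beta> \<le> I (I \<beta>)" "0 \<le> I \<beta>" "pos_def (C (I \<beta>))"
    using mono \<open>\<beta> \<in> F1 B h\<close> pd pos_def_Cmat_mono by auto
  then have "I \<beta> \<le> \<beta>" using max dual_feasible_iff by blast
  then have "I \<beta> = \<beta>" using \<open>\<beta> \<le> I \<beta>\<close> by (rule antisym)
  moreover have "\<beta>' \<le> \<beta>" if "fixed_point (F1 B h) I \<beta>'" for \<beta>'
    using that max dual_feasible_iff [of \<beta>'] by (simp add: fixed_point_def F1_iff)
  ultimately show ?thesis
    using \<open>\<beta> \<in> F1 B h\<close> by (simp add: maximal_fixed_point_def fixed_point_def)
qed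

lemma dual_optimal_stable:
  assumes "\<And>k. (\<sigma> k)\<^sup>2 > 0" "dual_optimal B h \<gamma> \<sigma> \<beta>"
  shows "stable_point (F1 B h) I \<beta>"
proof (rule stable_fixed_point [OF slater_in_F1 slater_less_interference])
  show "I \<beta> = \<beta>"
    using dual_optimal_maximal_fixed_point [of \<sigma>] assms
    by (simp add: maximal_fixed_point_def fixed_point_def)
  show "\<beta>0 \<le> \<beta>" using dual_optimal_upper_bound [of \<sigma>] assms slater_dual_feasible by blast
qed

end

text \<open>An infeasible primal problem counts as bounded, and weak duality then gives no bound on
  the dual. Existence is therefore stated under feasibility, and stability for any given maximal
  fixed point that is dual optimal.\<close>

theorem theorem2:
  fixes B :: "complex^'m^'m"
    and h :: "'k::finite \<Rightarrow> complex^'m"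
    and \<gamma> \<sigma> :: "'k \<Rightarrow> real"
  assumes "hermitian B"
    and "\<And>k. \<gamma> k > 0"
    and "\<And>k. (\<sigma> k)\<^sup>2 > 0"
    and "gdb_bounded B h \<gamma> \<sigma>"
    and "dual_slater B h \<gamma>"
  shows "(gdb_feasible h \<gamma> \<sigma> \<noteq> {} \<longrightarrow>
            (\<exists>\<beta>s. maximal_fixed_point (F1 B h) (interference B h \<gamma>) \<beta>s \<and>
                  (\<forall>\<beta>. dual_optimal B h \<gamma> \<sigma> \<beta> \<longleftrightarrow> \<beta> = \<beta>s))) \<and>
         (\<forall>\<beta>s. maximal_fixed_point (F1 B h) (interference B h \<gamma>) \<beta>s \<and>
               dual_optimal B h \<gamma> \<sigma> \<beta>s \<longrightarrow>
            stable_point (F1 B h) (interference B h \<gamma>) \<beta>s \<and>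
            (\<forall>\<beta>. fixed_point (F1 B h) (interference B h \<gamma>) \<beta> \<and> \<beta> \<noteq> \<beta>s \<longrightarrow>
                 unstable_point (F1 B h) (interference B h \<gamma>) \<beta>))"
proof -
  interpret gdb B h \<gamma> by unfold_locales (rule assms)+
  obtain \<beta>0 where \<beta>0: "0 \<le> \<beta>0" "\<And>k. pos_def (slack \<beta>0 k)"
    using assms(5) by (auto simp: dual_slater_def Fset_def F1_def)
  \<comment> \<open>A dual optimal point rules out zero channels, which supplies the remaining
    locale assumption.\<close>
  have slater: "gdb_slater B h \<gamma> \<beta>0" if "dual_optimal B h \<gamma> \<sigma> \<beta>" for \<beta>
    by unfold_locales (use \<beta>0 dual_optimal_nonzero_channel [OF assms(3) that] in auto)
  show ?thesis
  proof (intro conjI impI allI; (elim conjE)?)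
    assume "gdb_feasible h \<gamma> \<sigma> \<noteq> {}"
    moreover have "dual_feasible B h \<gamma> \<noteq> {}"
      using \<beta>0 pos_def_imp_psd by (auto simp: dual_feasible_def)
    ultimately obtain \<beta>s where opt: "dual_optimal B h \<gamma> \<sigma> \<beta>s"
      using dual_optimal_exists [of \<sigma>] assms(3) by blast
    have "maximal_fixed_point (F1 B h) I \<beta>s"
      by (rule gdb_slater.dual_optimal_maximal_fixed_point [OF slater [OF opt] assms(3) opt])
    moreover have "\<beta> = \<beta>s" if "dual_optimal B h \<gamma> \<sigma> \<beta>" for \<beta>
      by (rule dual_optimal_unique [OF assms(3) that opt])
    ultimately show "\<exists>\<beta>s. maximal_fixed_point (F1 B h) I \<beta>s \<and>
        (\<forall>\<beta>. dual_optimal B h \<gamma> \<sigma> \<beta> \<longleftrightarrow> \<beta> = \<beta>s)"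
      using opt by metis
  next
    fix \<beta>s
    assume opt: "dual_optimal B h \<gamma> \<sigma> \<beta>s"
    then interpret gdb_slater B h \<gamma> \<beta>0 by (rule slater)
    show "stable_point (F1 B h) I \<beta>s" by (rule dual_optimal_stable [OF assms(3) opt])
    fix \<beta>
    assume "maximal_fixed_point (F1 B h) I \<beta>s" "fixed_point (F1 B h) I \<beta>" "\<beta> \<noteq> \<beta>s"
    then show "unstable_point (F1 B h) I \<beta>"
      by (intro unstable_fixed_point [of \<beta> \<beta>s]) (auto simp: maximal_fixed_point_def fixed_point_def)
  qed
qed

end
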